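(* If both components of the pairs $(G,U)\in\mathrm{Obj}(\mathcal{G}_s)$ are restricted to Hopfian groups (that is, only pairs with $G$ and $U$ Hopfian are considered), then the pre-order of transfer targets $V/V'\preceq U/U'$ is a partial order: it is reflexive, transitive, and antisymmetric, i.e. $V/V'\preceq U/U'$ and $U/U'\preceq V/V'$ imply $V/V'=U/U'$ in the sense of equality of transfer targets.
   Context: A group $X$ is Hopfian if every epimorphism $X\to X$ is an isomorphism. $X'=[X,X]$. The category $\mathcal{G}_s$ has as objects the pairs $(G,U)$ of a group $G$ and a subgroup $U\le G$, and as morphisms $\varphi:(G,U)\to(H,V)$ the epimorphisms $\varphi:G\to H$ with $\varphi(G)=H$ and $\varphi(U)=V$. Such a morphism induces an epimorphism $\tilde\varphi:U/U'\to V/V'$, $xU'\mapsto\varphi(x)V'$. The transfer target of the pair $(G,U)$ is $U/U'$, regarded as attached to the pair. For two pairs $(G,U)$, $(H,V)$, precedence $V/V'\preceq U/U'$ means that there is a morphism $\varphi:(G,U)\to(H,V)$, so that $V/V'\simeq(U/U')/\ker(\tilde\varphi)$ via $\tilde\varphi$. Equality $V/V'=U/U'$ means that there is a morphism $\varphi:(G,U)\to(H,V)$ for which the induced epimorphism $\tilde\varphi:U/U'\to V/V'$ is an isomorphism. *)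

theory Defs
  imports "HOL-Algebra.Algebra"
begin

definition hopfian :: "('a, 'm) monoid_scheme \<Rightarrow> bool" where
  "hopfian G \<longleftrightarrow> group G \<and> (\<forall>f \<in> epi G G. f \<in> iso G G)"

type_synonym ('a, 'm) group_pair = "('a, 'm) monoid_scheme \<times> 'a set"

definition Gs_obj :: "('a, 'm) group_pair set" where
  "Gs_obj = {(G, U). group G \<and> subgroup U G}"

definition Gs_mor ::
    "('a, 'm) group_pair \<Rightarrow> ('b, 'n) group_pair \<Rightarrow> ('a \<Rightarrow> 'b) set" where
  "Gs_mor P Q = {\<phi>. \<phi> \<in> epi (fst P) (fst Q) \<and> \<phi> ` snd P = snd Q}"

definition Gs_hopfian_obj :: "('a, 'm) group_pair set" where
  "Gs_hopfian_obj = {(G, U) \<in> Gs_obj. hopfian G \<and> hopfian (G\<lparr>carrier := U\<rparr>)}"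

definition transfer_target :: "('a, 'm) group_pair \<Rightarrow> 'a set monoid" where
  "transfer_target = (\<lambda>(G, U). (G\<lparr>carrier := U\<rparr>) Mod derived (G\<lparr>carrier := U\<rparr>) U)"

text \<open>For a morphism \<open>\<phi>\<close> all elements of a coset \<open>C\<close> of \<open>U'\<close> have images in one and the same
  coset of \<open>V'\<close>, so the image set below is a singleton; see \<open>induced_map_coset\<close>.  The cosets
  are right cosets, as in the library's \<open>Mod\<close>, but \<open>U'\<close> and \<open>V'\<close> are normal in \<open>U\<close> and \<open>V\<close>.\<close>

definition induced_map ::
    "('b, 'n) group_pair \<Rightarrow> ('a \<Rightarrow> 'b) \<Rightarrow> 'a set \<Rightarrow> 'b set" where
  "induced_map = (\<lambda>(H, V) \<phi> C.
     the_elem ((\<lambda>x. derived (H\<lparr>carrier := V\<rparr>) V #>\<^bsub>H\<lparr>carrier := V\<rparr>\<^esub> \<phi> x) ` C))"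

text \<open>Transfer targets are regarded as attached to their pairs, so both relations are
  relations between pairs; the pairs may live over different types.
  \<open>tt_le Q P\<close> is \<open>V/V' \<preceq> U/U'\<close> and \<open>tt_eq Q P\<close> is \<open>V/V' = U/U'\<close>
  for \<open>P = (G, U)\<close>, \<open>Q = (H, V)\<close>; in both, the morphism goes from \<open>P\<close> to \<open>Q\<close>.
  Note that \<open>tt_eq\<close> is not literal equality, and it is not symmetric in general.\<close>

definition tt_le :: "('b, 'n) group_pair \<Rightarrow> ('a, 'm) group_pair \<Rightarrow> bool" where
  "tt_le Q P \<longleftrightarrow> (\<exists>\<phi>. \<phi> \<in> Gs_mor P Q)"

definition tt_eq :: "('b, 'n) group_pair \<Rightarrow> ('a, 'm) group_pair \<Rightarrow> bool" where
  "tt_eq Q P \<longleftrightarrow>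
     (\<exists>\<phi> \<in> Gs_mor P Q. induced_map Q \<phi> \<in> iso (transfer_target P) (transfer_target Q))"

lemma Gs_mor_restrict_hom:
  assumes "(G, U) \<in> Gs_obj" "(H, V) \<in> Gs_obj" "\<phi> \<in> Gs_mor (G, U) (H, V)"
  shows "group_hom (G\<lparr>carrier := U\<rparr>) (H\<lparr>carrier := V\<rparr>) \<phi>"
proof -
  have "group (G\<lparr>carrier := U\<rparr>)" "group (H\<lparr>carrier := V\<rparr>)"
    using assms by (auto simp: Gs_obj_def subgroup.subgroup_is_group)
  moreover have "\<phi> \<in> hom (G\<lparr>carrier := U\<rparr>) (H\<lparr>carrier := V\<rparr>)"
    using assms subgroup.subset[of U G]
    by (auto simp: Gs_obj_def Gs_mor_def epi_def hom_def subset_iff)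
  ultimately show ?thesis
    by (simp add: group_hom_def group_hom_axioms_def)
qed

lemma induced_map_coset:
  assumes P: "(G, U) \<in> Gs_obj" and Q: "(H, V) \<in> Gs_obj"
    and \<phi>: "\<phi> \<in> Gs_mor (G, U) (H, V)" and x: "x \<in> U"
  shows "induced_map (H, V) \<phi> (derived (G\<lparr>carrier := U\<rparr>) U #>\<^bsub>G\<lparr>carrier := U\<rparr>\<^esub> x)
         = derived (H\<lparr>carrier := V\<rparr>) V #>\<^bsub>H\<lparr>carrier := V\<rparr>\<^esub> \<phi> x"
proof -
  let ?U = "G\<lparr>carrier := U\<rparr>" and ?V = "H\<lparr>carrier := V\<rparr>"
  let ?U' = "derived ?U U" and ?V' = "derived ?V V"
  interpret \<phi>: group_hom ?U ?V \<phi>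
    by (rule Gs_mor_restrict_hom[OF P Q \<phi>])
  have img: "\<phi> ` U = V" using \<phi> by (simp add: Gs_mor_def)
  have sU: "subgroup ?U' ?U" using \<phi>.G.derived_is_subgroup[of U] by simp
  have sV: "subgroup ?V' ?V" using \<phi>.H.derived_is_subgroup[of V] by simp
  have d: "\<phi> ` ?U' = ?V'" using \<phi>.derived_img[of U] img by simp
  have "?V' #>\<^bsub>?V\<^esub> \<phi> y = ?V' #>\<^bsub>?V\<^esub> \<phi> x" if y: "y \<in> ?U' #>\<^bsub>?U\<^esub> x" for y
  proof -
    obtain u where u: "u \<in> ?U'" "y = u \<otimes>\<^bsub>?U\<^esub> x"
      using y by (auto simp: r_coset_def)
    have uU: "u \<in> U" using u(1) subgroup.subset[OF sU] by auto
    have "\<phi> y = \<phi> u \<otimes>\<^bsub>?V\<^esub> \<phi> x"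
      using \<phi>.hom_mult[of u x] u(2) uU x by simp
    moreover have "\<phi> u \<in> ?V'" using d u(1) by blast
    ultimately have "\<phi> y \<in> ?V' #>\<^bsub>?V\<^esub> \<phi> x" by (auto simp: r_coset_def)
    then show ?thesis
      using \<phi>.H.repr_independence[OF _ _ sV, of "\<phi> y" "\<phi> x"] \<phi>.hom_closed[of x] x by simp
  qed
  moreover have "x \<in> ?U' #>\<^bsub>?U\<^esub> x"
    using \<phi>.G.rcos_self[OF _ sU, of x] x by simp
  ultimately have "(\<lambda>y. ?V' #>\<^bsub>?V\<^esub> \<phi> y) ` (?U' #>\<^bsub>?U\<^esub> x) = {?V' #>\<^bsub>?V\<^esub> \<phi> x}"
    by blast
  then show ?thesis by (simp add: induced_map_def)
qed

end

theory Submission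
  imports Defs
begin

text \<open>
  Reflexivity and transitivity hold because identities and composites of morphisms of pairs are
  morphisms. For antisymmetry, let \<open>\<phi>\<close> go from \<open>(G, U)\<close> to \<open>(H, V)\<close> and \<open>\<psi>\<close> back. The composite
  \<open>\<psi> \<circ> \<phi>\<close> is an epimorphism from \<open>G\<close> to itself, hence injective by the Hopfian property, and so
  \<open>\<phi>\<close> is injective, in particular on \<open>U\<close>. The induced map of \<open>\<phi>\<close> is the one that the first
  isomorphism theorem attaches to the epimorphism \<open>x \<mapsto> V' \<phi>(x)\<close> from \<open>U\<close> to \<open>V/V'\<close>. Its kernel
  consists of the elements of \<open>U\<close> that \<open>\<phi>\<close> sends into \<open>V' = \<phi>(U')\<close>; when \<open>\<phi>\<close> is injective on \<open>U\<close>,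
  that kernel is \<open>U'\<close> itself, so the induced map is an isomorphism from \<open>U/U'\<close> to \<open>V/V'\<close>.
\<close>

lemma Gs_mor_id: "(\<lambda>x. x) \<in> Gs_mor P P"
  using iso_set_refl[of "fst P"] by (simp add: Gs_mor_def iso_iff_mon_epi)

lemma Gs_mor_compose:
  assumes "\<phi> \<in> Gs_mor P Q" and "\<psi> \<in> Gs_mor Q R"
  shows "\<psi> \<circ> \<phi> \<in> Gs_mor P R"
  using assms epi_compose[of \<phi> "fst P" "fst Q" \<psi> "fst R"]
  by (auto simp: Gs_mor_def simp flip: image_image)

lemma Gs_mor_inj_on_of_hopfian:
  assumes G: "hopfian G" and \<phi>: "\<phi> \<in> Gs_mor (G, U) Q" and \<psi>: "\<psi> \<in> Gs_mor Q (G, U)"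
  shows "inj_on \<phi> (carrier G)"
proof -
  have "\<psi> \<circ> \<phi> \<in> epi G G"
    using Gs_mor_compose[OF \<phi> \<psi>] by (simp add: Gs_mor_def)
  then have "inj_on (\<psi> \<circ> \<phi>) (carrier G)"
    using G by (auto simp: hopfian_def iso_def bij_betw_def)
  then show ?thesis by (rule inj_on_imageI2)
qed

text \<open>The first isomorphism theorem applies verbatim: unfolding \<open>induced_map\<close> yields the library's
  map \<open>X \<mapsto> the_elem (f ` X)\<close> for \<open>f x = V' #> \<phi> x\<close>, and injectivity identifies the kernel of \<open>f\<close>.\<close>

lemma induced_map_iso_of_inj_on:
  assumes P: "(G, U) \<in> Gs_obj" and Q: "(H, V) \<in> Gs_obj"
    and \<phi>: "\<phi> \<in> Gs_mor (G, U) (H, V)" and inj: "inj_on \<phi> U"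
  shows "induced_map (H, V) \<phi> \<in> iso (transfer_target (G, U)) (transfer_target (H, V))"
proof -
  let ?U = "G\<lparr>carrier := U\<rparr>" and ?V = "H\<lparr>carrier := V\<rparr>"
  let ?U' = "derived ?U U" and ?V' = "derived ?V V"
  let ?f = "\<lambda>x. ?V' #>\<^bsub>?V\<^esub> \<phi> x"
  interpret \<phi>: group_hom ?U ?V \<phi>
    by (rule Gs_mor_restrict_hom[OF P Q \<phi>])
  interpret V': normal ?V' ?V
    using \<phi>.H.derived_self_is_normal by simp
  have img: "\<phi> ` U = V" using \<phi> by (simp add: Gs_mor_def)
  have U'_sub: "?U' \<subseteq> U"
    using subgroup.subset[OF \<phi>.G.derived_is_subgroup[of U]] by simp
  have img': "\<phi> ` ?U' = ?V'" using \<phi>.derived_img[of U] img by simp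
  have "?f \<in> hom ?U (?V Mod ?V')"
    using hom_compose[OF \<phi>.homh V'.r_coset_hom_Mod] by (simp add: comp_def)
  then interpret f: group_hom ?U "?V Mod ?V'" ?f
    using V'.factorgroup_is_group \<phi>.G.is_group
    by (simp add: group_hom_def group_hom_axioms_def)
  have surj: "?f ` carrier ?U = carrier (?V Mod ?V')"
    using img by (auto simp: carrier_FactGroup)
  have "?f x = ?V' \<longleftrightarrow> x \<in> ?U'" if x: "x \<in> U" for x
  proof -
    have "?f x = ?V' \<longleftrightarrow> \<phi> x \<in> ?V'"
      using \<phi>.hom_closed[of x] x V'.rcos_const \<phi>.H.coset_join1[OF _ _ V'.is_subgroup, of "\<phi> x"]
        V'.subset by auto
    also have "\<dots> \<longleftrightarrow> x \<in> ?U'"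
      using inj_on_image_mem_iff[OF inj x U'_sub] img' by simp
    finally show ?thesis .
  qed
  then have "kernel ?U (?V Mod ?V') ?f = ?U'"
    using U'_sub by (auto simp: kernel_def)
  then show ?thesis
    using f.FactGroup_iso_set[OF surj] by (simp add: induced_map_def transfer_target_def)
qed

theorem corollary5p1:
  shows "(\<forall>P :: ('a, 'm) group_pair. P \<in> Gs_hopfian_obj \<longrightarrow> tt_le P P) \<and>
    (\<forall>(P :: ('a, 'm) group_pair) (Q :: ('b, 'n) group_pair) (R :: ('c, 'k) group_pair).
       P \<in> Gs_hopfian_obj \<longrightarrow> Q \<in> Gs_hopfian_obj \<longrightarrow> R \<in> Gs_hopfian_obj \<longrightarrow>
       tt_le R Q \<longrightarrow> tt_le Q P \<longrightarrow> tt_le R P) \<and>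
    (\<forall>(P :: ('a, 'm) group_pair) (Q :: ('b, 'n) group_pair).
       P \<in> Gs_hopfian_obj \<longrightarrow> Q \<in> Gs_hopfian_obj \<longrightarrow>
       tt_le Q P \<longrightarrow> tt_le P Q \<longrightarrow> tt_eq Q P)"
proof (intro conjI allI impI)
  fix P :: "('a, 'm) group_pair"
  show "tt_le P P" using Gs_mor_id unfolding tt_le_def by blast
next
  fix P :: "('a, 'm) group_pair" and Q :: "('b, 'n) group_pair" and R :: "('c, 'k) group_pair"
  assume "tt_le R Q" "tt_le Q P"
  then show "tt_le R P" using Gs_mor_compose unfolding tt_le_def by blast
next
  fix P :: "('a, 'm) group_pair" and Q :: "('b, 'n) group_pair"
  assume "P \<in> Gs_hopfian_obj" "Q \<in> Gs_hopfian_obj" "tt_le Q P" "tt_le P Q"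
  moreover obtain G U H V where PQ: "P = (G, U)" "Q = (H, V)"
    by (cases P, cases Q)
  ultimately obtain \<phi> \<psi> where obj: "(G, U) \<in> Gs_obj" "(H, V) \<in> Gs_obj"
    and G: "hopfian G"
    and \<phi>: "\<phi> \<in> Gs_mor (G, U) (H, V)" and \<psi>: "\<psi> \<in> Gs_mor (H, V) (G, U)"
    by (auto simp: Gs_hopfian_obj_def tt_le_def)
  have "U \<subseteq> carrier G"
    using obj(1) by (simp add: Gs_obj_def subgroup.subset)
  then have "inj_on \<phi> U"
    using inj_on_subset Gs_mor_inj_on_of_hopfian[OF G \<phi> \<psi>] by blast
  then show "tt_eq Q P"
    using induced_map_iso_of_inj_on[OF obj \<phi>] \<phi> unfolding tt_eq_def PQ by blast
qed

end
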